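(* Let $f:\mathbb{U}\to\mathbb{U}$ be a (complex-valued) harmonic map of the unit disk into itself and let $s=\tan\big(\frac{\pi}{4}(|f(0)|+1)\big)$. Assume that there is a point $b\in\mathbb{T}$ such that $f$ extends continuously to $b$, $|f(b)|=1$, and $f$ is $\mathbb{R}$-differentiable at $b$. Then $$\Lambda_f(b)\ge\frac{2}{s\pi}.$$
   Context: $\mathbb{U}$ is the open unit disk in $\mathbb{C}$ and $\mathbb{T}$ the unit circle. $\mathbb{R}$-differentiability of $f$ at the boundary point $b$ means that the extended map on $\mathbb{U}\cup\{b\}$ has a real-linear differential $(df)_b:\mathbb{C}\to\mathbb{C}$ with $f(z)=f(b)+(df)_b(z-b)+o(|z-b|)$ as $z\to b$, $z\in\mathbb{U}$. $\Lambda_f(b)=\|(df)_b\|=|\partial f(b)|+|\bar\partial f(b)|$ is the operator norm of this differential. *)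

theory Defs
  imports "HOL-Analysis.Analysis"
begin

text \<open>
  In real dimension two, with \<open>x = Re z\<close> and \<open>y = Im z\<close>, the directional derivative is the partial
  derivative in \<open>x\<close> for direction \<open>v = 1\<close> and the one in \<open>y\<close> for \<open>v = \<i>\<close>.
  All derivatives are over the reals.
\<close>

definition dir_deriv :: "complex \<Rightarrow> (complex \<Rightarrow> complex) \<Rightarrow> complex \<Rightarrow> complex" where
  "dir_deriv v f z = frechet_derivative f (at z) v"

text \<open>Only meant for open \<open>S\<close>: derivatives are taken in full neighbourhoods.\<close>

definition C1_on :: "complex set \<Rightarrow> (complex \<Rightarrow> complex) \<Rightarrow> bool" where
  "C1_on S f \<longleftrightarrow>
     (\<forall>z\<in>S. f differentiable (at z)) \<and> (\<forall>v. continuous_on S (dir_deriv v f))"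

definition C2_on :: "complex set \<Rightarrow> (complex \<Rightarrow> complex) \<Rightarrow> bool" where
  "C2_on S f \<longleftrightarrow> C1_on S f \<and> (\<forall>v. C1_on S (dir_deriv v f))"

definition laplacian :: "(complex \<Rightarrow> complex) \<Rightarrow> complex \<Rightarrow> complex" where
  "laplacian f z = dir_deriv 1 (dir_deriv 1 f) z + dir_deriv \<i> (dir_deriv \<i> f) z"

definition harmonic_on :: "complex set \<Rightarrow> (complex \<Rightarrow> complex) \<Rightarrow> bool" where
  "harmonic_on S f \<longleftrightarrow> open S \<and> C2_on S f \<and> (\<forall>z\<in>S. laplacian f z = 0)"

text \<open>
  A map on an open set \<open>S\<close> together with its extension to a boundary point \<open>b\<close> of \<open>S\<close> is rendered
  as one total function \<open>f\<close>, whose value \<open>f b\<close> is the value of the extension; \<^const>\<open>harmonic_on\<close>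
  depends only on \<open>f\<close> restricted to \<open>S\<close>. The real differential of the extended map at \<open>b\<close> is then
  a derivative at \<open>b\<close> within \<open>insert b S\<close>, and its operator norm is \<^const>\<open>onorm\<close>.
\<close>

end

theory Submission
  imports Defs "HOL-Complex_Analysis.Conformal_Mappings"
begin

text \<open>
  After rotating by \<open>cnj (f b)\<close> only the real harmonic function \<open>u = Re (cnj (f b) * f)\<close> matters: it
  maps the disk into \<open>(-1, 1)\<close>, equals \<open>1\<close> at \<open>b\<close>, and its derivative at \<open>b\<close> in the outward
  radial direction, \<open>Re (cnj (f b) * D b)\<close>, is at most \<open>onorm D\<close>. So it suffices to bound
  \<open>(1 - u (r b)) / (1 - r)\<close> from below as \<open>r \<rightarrow> 1\<close>.

  On the disk \<open>u = Re g\<close> for a holomorphic \<open>g\<close> (\<open>harmonic_on_Re_holomorphic\<close>), obtained as a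
  primitive of \<open>u\<^sub>x - \<i> u\<^sub>y\<close>. One Cauchy--Riemann equation for that function is harmonicity of
  \<open>u\<close>; the other is the symmetry of the mixed second derivatives (\<open>mixed_derivatives_commute\<close>).

  The values of \<open>g\<close> lie in the strip \<open>\<bar>Re w\<bar> < 1\<close>, and \<open>w \<mapsto> exp (\<i> \<pi> w / 2)\<close> maps this strip to the
  right half-plane, turning real parts into arguments: \<open>u\<close> close to \<open>1\<close> means that
  \<open>P = exp (\<i> \<pi> g / 2)\<close> has argument close to \<open>\<pi>/2\<close>. The Schwarz lemma, transported to the
  half-plane, limits how close the argument of \<open>P z\<close> can get to \<open>\<pi>/2\<close> in terms of \<open>\<bar>z\<bar>\<close> and \<open>P 0\<close>
  (\<open>Re_pos_holomorphic_argument_bound\<close>). With \<open>\<alpha> = \<pi> u(0) / 2\<close> and \<open>r = \<bar>z\<bar>\<close> this becomes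
  \<open>(1 - r\<^sup>2) cos \<alpha> \<le> \<pi>/2 (1 - u z) (1 + r\<^sup>2 + 2 r \<bar>sin \<alpha>\<bar>)\<close>. Dividing by \<open>1 - r\<close> and letting \<open>r \<rightarrow> 1\<close>
  along the radius gives \<open>2/\<pi> \<cdot> cos \<alpha> / (1 + \<bar>sin \<alpha>\<bar>)\<close> as a lower bound for the radial
  derivative. This is smallest when \<open>\<bar>\<alpha>\<bar>\<close> is as large as possible, namely \<open>\<beta> = \<pi> \<bar>f 0\<bar> / 2\<close>, and
  \<open>cos \<beta> / (1 + sin \<beta>) = 1 / tan (\<pi>/4 + \<beta>/2) = 1/s\<close>.
\<close>

section \<open>Symmetry of mixed second derivatives\<close>

text \<open>
  Two applications of the mean value theorem: first to the increment of \<open>u\<close> in direction \<open>w\<close>, as a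
  function of the displacement along \<open>v\<close>, then to the derivative of \<open>u\<close> along \<open>v\<close>, as a function of
  the displacement along \<open>w\<close>. The left-hand side of the conclusion is symmetric in \<open>v\<close> and \<open>w\<close>,
  which is what makes the order of differentiation immaterial.
\<close>
lemma second_difference_mean_value:
  fixes u :: "'a::real_normed_vector \<Rightarrow> real"
  assumes "t > 0"
    and S: "\<And>p q. \<lbrakk>p \<in> {0..t}; q \<in> {0..t}\<rbrakk> \<Longrightarrow> z + p *\<^sub>R v + q *\<^sub>R w \<in> S"
    and u: "\<And>x. x \<in> S \<Longrightarrow> (u has_derivative u' x) (at x)"
    and A: "\<And>x. x \<in> S \<Longrightarrow> ((\<lambda>y. u' y v) has_derivative A x) (at x)"
  obtains p q where "p \<in> {0<..<t}" "q \<in> {0<..<t}"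
    "u (z + t *\<^sub>R v + t *\<^sub>R w) - u (z + t *\<^sub>R v) - u (z + t *\<^sub>R w) + u z
      = t\<^sup>2 * A (z + p *\<^sub>R v + q *\<^sub>R w) w"
proof -
  have S0: "z + p *\<^sub>R v \<in> S" if "p \<in> {0..t}" for p
    using S[of p 0] that \<open>t > 0\<close> by simp
  define \<phi> where "\<phi> p = u (z + p *\<^sub>R v + t *\<^sub>R w) - u (z + p *\<^sub>R v)" for p
  have u_lin: "u' x (h *\<^sub>R y) = h * u' x y" if "x \<in> S" for x h y
    using linear_cmul[OF has_derivative_linear[OF u[OF that]]] by simp
  have A_lin: "A x (h *\<^sub>R y) = h * A x y" if "x \<in> S" for x h y
    using linear_cmul[OF has_derivative_linear[OF A[OF that]]] by simp
  have "(\<phi> has_derivative (\<lambda>h. u' (z + p *\<^sub>R v + t *\<^sub>R w) (h *\<^sub>R v) - u' (z + p *\<^sub>R v) (h *\<^sub>R v)))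
      (at p within {0..t})" if "0 \<le> p" "p \<le> t" for p
    unfolding \<phi>_def
    by (rule has_derivative_diff;
        rule has_derivative_compose[where g = u and f' = "\<lambda>h. h *\<^sub>R v"];
        use that \<open>t > 0\<close> in \<open>auto intro!: derivative_eq_intros u S S0\<close>)
  from mvt_simple[OF \<open>t > 0\<close> this] obtain p where p: "p \<in> {0<..<t}"
    "\<phi> t - \<phi> 0 = u' (z + p *\<^sub>R v + t *\<^sub>R w) (t *\<^sub>R v) - u' (z + p *\<^sub>R v) (t *\<^sub>R v)"
    by auto
  have "((\<lambda>q. u' (z + p *\<^sub>R v + q *\<^sub>R w) v) has_derivative
      (\<lambda>h. A (z + p *\<^sub>R v + q *\<^sub>R w) (h *\<^sub>R w))) (at q within {0..t})" if "0 \<le> q" "q \<le> t" for q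
    by (rule has_derivative_compose[where g = "\<lambda>y. u' y v" and f' = "\<lambda>h. h *\<^sub>R w"];
        use that p(1) in \<open>auto intro!: derivative_eq_intros A S\<close>)
  from mvt_simple[OF \<open>t > 0\<close> this] obtain q where q: "q \<in> {0<..<t}"
    "u' (z + p *\<^sub>R v + t *\<^sub>R w) v - u' (z + p *\<^sub>R v) v = A (z + p *\<^sub>R v + q *\<^sub>R w) (t *\<^sub>R w)"
    by auto
  have mem: "z + p *\<^sub>R v + t *\<^sub>R w \<in> S" "z + p *\<^sub>R v \<in> S" "z + p *\<^sub>R v + q *\<^sub>R w \<in> S"
    using p(1) q(1) S[of p t] S[of p q] S0[of p] by auto
  have "\<phi> t - \<phi> 0 = t * (u' (z + p *\<^sub>R v + t *\<^sub>R w) v - u' (z + p *\<^sub>R v) v)"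
    using p(2) mem by (simp add: u_lin right_diff_distrib)
  also have "\<dots> = t\<^sup>2 * A (z + p *\<^sub>R v + q *\<^sub>R w) w"
    using q(2) mem by (simp add: A_lin power2_eq_square)
  finally show ?thesis
    using that[OF p(1) q(1)] by (simp add: \<phi>_def)
qed

text \<open>
  The second difference on a small parallelogram at \<open>z\<close> is a multiple of a value of either mixed
  derivative at some point of the parallelogram, so both mixed derivatives take a common value
  arbitrarily close to \<open>z\<close>, possibly at different points; continuity carries this over to \<open>z\<close>.
\<close>
lemma mixed_derivatives_commute:
  fixes u :: "'a::real_normed_vector \<Rightarrow> real"
  assumes "open S" "z \<in> S"
    and u: "\<And>x. x \<in> S \<Longrightarrow> (u has_derivative u' x) (at x)"
    and A: "\<And>x. x \<in> S \<Longrightarrow> ((\<lambda>y. u' y v) has_derivative A x) (at x)"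
    and B: "\<And>x. x \<in> S \<Longrightarrow> ((\<lambda>y. u' y w) has_derivative B x) (at x)"
    and contA: "continuous_on S (\<lambda>x. A x w)"
    and contB: "continuous_on S (\<lambda>x. B x v)"
  shows "A z w = B z v"
proof -
  have "\<bar>A z w - B z v\<bar> < e" if "e > 0" for e
  proof -
    have "\<forall>\<^sub>F x in nhds z. \<bar>A x w - A z w\<bar> < e/2 \<and> \<bar>B x v - B z v\<bar> < e/2 \<and> x \<in> S"
    proof (intro eventually_conj)
      have "((\<lambda>x. A x w) \<longlongrightarrow> A z w) (nhds z)"
        using contA assms(1,2) continuous_on_eq_continuous_at isCont_def tendsto_at_iff_tendsto_nhds
        by blast
      from tendstoD[OF this, of "e/2"] that
      show "\<forall>\<^sub>F x in nhds z. \<bar>A x w - A z w\<bar> < e/2" by (simp add: dist_real_def)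
      have "((\<lambda>x. B x v) \<longlongrightarrow> B z v) (nhds z)"
        using contB assms(1,2) continuous_on_eq_continuous_at isCont_def tendsto_at_iff_tendsto_nhds
        by blast
      from tendstoD[OF this, of "e/2"] that
      show "\<forall>\<^sub>F x in nhds z. \<bar>B x v - B z v\<bar> < e/2" by (simp add: dist_real_def)
      show "\<forall>\<^sub>F x in nhds z. x \<in> S" using assms(1,2) by (rule eventually_nhds_in_open)
    qed
    then obtain d where "d > 0"
      and d: "\<And>x. dist x z < d \<Longrightarrow> \<bar>A x w - A z w\<bar> < e/2 \<and> \<bar>B x v - B z v\<bar> < e/2 \<and> x \<in> S"
      unfolding eventually_nhds_metric by blast
    \<comment> \<open>Small enough for the parallelogram spanned by \<open>t *\<^sub>R v\<close> and \<open>t *\<^sub>R w\<close> at \<open>z\<close> to stay in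
      the ball of radius \<open>d\<close>; the \<open>1\<close> covers \<open>v = w = 0\<close>.\<close>
    define t where "t = d / (norm v + norm w + 1)"
    have pos: "norm v + norm w + 1 > 0" by (simp add: add_nonneg_pos)
    have "t > 0" using \<open>d > 0\<close> pos by (simp add: t_def)
    have near: "dist (z + p *\<^sub>R v + q *\<^sub>R w) z < d" if "p \<in> {0..t}" "q \<in> {0..t}" for p q
    proof -
      have "dist (z + p *\<^sub>R v + q *\<^sub>R w) z \<le> norm (p *\<^sub>R v) + norm (q *\<^sub>R w)"
        by (simp add: dist_norm add.assoc norm_triangle_ineq del: norm_scaleR)
      also have "\<dots> \<le> t * norm v + t * norm w"
        using that by (intro add_mono) (auto intro: mult_right_mono)
      also have "\<dots> < t * (norm v + norm w + 1)"
        using \<open>t > 0\<close> by (simp add: algebra_simps)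
      also have "\<dots> = d" using pos by (simp add: t_def)
      finally show ?thesis .
    qed
    have near': "dist (z + p *\<^sub>R w + q *\<^sub>R v) z < d" if "p \<in> {0..t}" "q \<in> {0..t}" for p q
      using near[OF that(2,1)] by (simp add: add_ac)
    obtain p q where pq: "p \<in> {0<..<t}" "q \<in> {0<..<t}"
      "u (z + t *\<^sub>R v + t *\<^sub>R w) - u (z + t *\<^sub>R v) - u (z + t *\<^sub>R w) + u z
        = t\<^sup>2 * A (z + p *\<^sub>R v + q *\<^sub>R w) w"
      by (rule second_difference_mean_value[OF \<open>t > 0\<close>, where S = S and z = z and v = v and w = w])
         (use near d u A in blast)+
    obtain p' q' where pq': "p' \<in> {0<..<t}" "q' \<in> {0<..<t}"
      "u (z + t *\<^sub>R w + t *\<^sub>R v) - u (z + t *\<^sub>R w) - u (z + t *\<^sub>R v) + u z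
        = t\<^sup>2 * B (z + p' *\<^sub>R w + q' *\<^sub>R v) v"
      by (rule second_difference_mean_value[OF \<open>t > 0\<close>, where S = S and z = z and v = w and w = v])
         (use near' d u B in blast)+
    have swap: "z + t *\<^sub>R w + t *\<^sub>R v = z + t *\<^sub>R v + t *\<^sub>R w" by simp
    have "t\<^sup>2 * A (z + p *\<^sub>R v + q *\<^sub>R w) w = t\<^sup>2 * B (z + p' *\<^sub>R w + q' *\<^sub>R v) v"
      using pq(3) pq'(3) unfolding swap by linarith
    then have "A (z + p *\<^sub>R v + q *\<^sub>R w) w = B (z + p' *\<^sub>R w + q' *\<^sub>R v) v"
      using \<open>t > 0\<close> by simp
    moreover have "\<bar>A (z + p *\<^sub>R v + q *\<^sub>R w) w - A z w\<bar> < e/2"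
      using d near pq(1,2) by simp
    moreover have "\<bar>B (z + p' *\<^sub>R w + q' *\<^sub>R v) v - B z v\<bar> < e/2"
      using d near' pq'(1,2) by simp
    ultimately show ?thesis by linarith
  qed
  from this[of "\<bar>A z w - B z v\<bar>"] show ?thesis by (cases "A z w = B z v") auto
qed

section \<open>Harmonic functions as real parts of holomorphic functions\<close>

lemma C1_on_has_derivative:
  assumes "C1_on S f" "z \<in> S"
  shows "(f has_derivative (\<lambda>v. dir_deriv v f z)) (at z)"
  using assms by (simp add: C1_on_def dir_deriv_def frechet_derivative_works[symmetric])

lemma Re_scaled_derivative_real_coordinates:
  assumes "bounded_linear (L :: complex \<Rightarrow> complex)"
  shows "Re (c * L h) = Re h * Re (c * L 1) + Im h * Re (c * L \<i>)"
proof -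
  interpret bounded_linear L by fact
  have "L h = L (Re h *\<^sub>R 1 + Im h *\<^sub>R \<i>)"
    by (rule arg_cong[of _ _ L]) (simp add: complex_eq_iff)
  also have "\<dots> = Re h *\<^sub>R L 1 + Im h *\<^sub>R L \<i>" by (simp only: add scaleR)
  finally show ?thesis by (simp add: algebra_simps)
qed

text \<open>
  If \<open>u = Re g\<close>, then \<open>g' = u\<^sub>x - \<i> u\<^sub>y\<close>. Conversely this expression is holomorphic when \<open>u\<close> is
  harmonic, so on a convex set it has a primitive, whose real part has the same differential as \<open>u\<close>
  and hence differs from \<open>u\<close> by a constant.
\<close>
lemma harmonic_on_Re_holomorphic:
  assumes harm: "harmonic_on S f" and "convex S"
  obtains g where "g holomorphic_on S" "\<And>z. z \<in> S \<Longrightarrow> Re (g z) = Re (c * f z)"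
proof -
  have "open S" and C1: "C1_on S f" and C1': "\<And>v. C1_on S (dir_deriv v f)"
    and lap: "\<And>z. z \<in> S \<Longrightarrow> dir_deriv 1 (dir_deriv 1 f) z = - dir_deriv \<i> (dir_deriv \<i> f) z"
    using harm by (auto simp: harmonic_on_def C2_on_def laplacian_def eq_neg_iff_add_eq_0)
  have D1: "((\<lambda>z. Re (c * f z)) has_derivative (\<lambda>v. Re (c * dir_deriv v f z))) (at z)"
    if "z \<in> S" for z
    by (intro has_derivative_Re has_derivative_mult_right C1_on_has_derivative[OF C1 that])
  have D2: "((\<lambda>z. Re (c * dir_deriv v f z)) has_derivative
      (\<lambda>w. Re (c * dir_deriv w (dir_deriv v f) z))) (at z)" if "z \<in> S" for z v
    by (intro has_derivative_Re has_derivative_mult_right C1_on_has_derivative[OF C1' that])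
  have cont: "continuous_on S (\<lambda>z. Re (c * dir_deriv w (dir_deriv v f) z))" for v w
    using C1'[of v] by (auto simp: C1_on_def intro!: continuous_intros)
  have sym: "Re (c * dir_deriv \<i> (dir_deriv 1 f) z) = Re (c * dir_deriv 1 (dir_deriv \<i> f) z)"
    if "z \<in> S" for z
    by (rule mixed_derivatives_commute[OF \<open>open S\<close> that D1 D2 D2 cont cont])
  define F where
    "F z = complex_of_real (Re (c * dir_deriv 1 f z)) - \<i> * complex_of_real (Re (c * dir_deriv \<i> f z))"
    for z
  have F': "(F has_field_derivative (complex_of_real (Re (c * dir_deriv 1 (dir_deriv 1 f) z))
      - \<i> * complex_of_real (Re (c * dir_deriv 1 (dir_deriv \<i> f) z)))) (at z)" if "z \<in> S" for z
  proof (rule has_derivative_imp_has_field_derivative)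
    show "(F has_derivative (\<lambda>h. complex_of_real (Re (c * dir_deriv h (dir_deriv 1 f) z))
      - \<i> * complex_of_real (Re (c * dir_deriv h (dir_deriv \<i> f) z)))) (at z)"
      unfolding F_def
      by (intro has_derivative_diff has_derivative_mult_right has_derivative_of_real D2 that)
  next
    fix h
    have bl: "bounded_linear (\<lambda>h. dir_deriv h (dir_deriv v f) z)" for v
      using C1_on_has_derivative[OF C1' that] by (rule has_derivative_bounded_linear)
    show "h * (complex_of_real (Re (c * dir_deriv 1 (dir_deriv 1 f) z))
        - \<i> * complex_of_real (Re (c * dir_deriv 1 (dir_deriv \<i> f) z)))
      = complex_of_real (Re (c * dir_deriv h (dir_deriv 1 f) z))
        - \<i> * complex_of_real (Re (c * dir_deriv h (dir_deriv \<i> f) z))"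
      unfolding Re_scaled_derivative_real_coordinates[OF bl, where c = c and h = h]
      using arg_cong[OF lap[OF that], of "\<lambda>x. Re (c * x)"] sym[OF that]
      by (simp add: complex_eq_iff) (simp add: algebra_simps)
  qed
  then have "F holomorphic_on S"
    by (meson field_differentiable_at_within field_differentiable_def holomorphic_on_def)
  then obtain g where g: "\<And>z. z \<in> S \<Longrightarrow> (g has_field_derivative F z) (at z within S)"
    using holomorphic_convex_primitive'[OF \<open>convex S\<close> \<open>open S\<close>] by blast
  have "((\<lambda>z. Re (g z) - Re (c * f z)) has_derivative (\<lambda>h. 0)) (at z within S)" if "z \<in> S" for z
  proof -
    have "((\<lambda>z. Re (g z) - Re (c * f z)) has_derivative
        (\<lambda>h. Re (F z * h) - Re (c * dir_deriv h f z))) (at z within S)"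
      by (intro has_derivative_diff has_derivative_Re
          has_derivative_at_withinI[OF D1[OF that]] has_field_derivative_imp_has_derivative[OF g[OF that]])
    moreover have "Re (F z * h) = Re (c * dir_deriv h f z)" for h
      unfolding Re_scaled_derivative_real_coordinates[OF
          has_derivative_bounded_linear[OF C1_on_has_derivative[OF C1 that]], of c h]
      by (simp add: F_def algebra_simps)
    ultimately show ?thesis by simp
  qed
  from has_derivative_zero_constant[OF \<open>convex S\<close> this]
  obtain k where k: "\<And>z. z \<in> S \<Longrightarrow> Re (g z) - Re (c * f z) = k" by blast
  have "g holomorphic_on S"
    using g by (auto simp: holomorphic_on_def field_differentiable_def)
  show ?thesis
  proof
    show "(\<lambda>z. g z - of_real k) holomorphic_on S"
      by (intro holomorphic_intros \<open>g holomorphic_on S\<close>)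
    show "Re (g z - of_real k) = Re (c * f z)" if "z \<in> S" for z
      using k[OF that] by simp
  qed
qed

section \<open>Schwarz lemma for the half-plane and for the strip\<close>

text \<open>
  The Moebius map \<open>w \<mapsto> (w - P 0) / (w + cnj (P 0))\<close> takes the right half-plane to the disk and \<open>P 0\<close>
  to \<open>0\<close>, so the Schwarz lemma bounds the image \<open>v\<close> of \<open>P z\<close> by \<open>\<bar>z\<bar>\<close>. Solving for \<open>P z\<close> expresses
  \<open>Re (P z)\<close> and \<open>\<bar>P z\<bar>\<close> through \<open>v\<close> with the common denominator \<open>\<bar>1 - v\<bar>\<^sup>2\<close>, which cancels from the
  quotient \<open>Re (P z) / \<bar>P z\<bar>\<close>, the cosine of the argument of \<open>P z\<close>; what remains is bounded below by a
  decreasing function of \<open>\<bar>v\<bar>\<close>.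
\<close>
lemma Re_pos_holomorphic_argument_bound:
  assumes hol: "P holomorphic_on ball 0 1"
    and pos: "\<And>z. z \<in> ball 0 1 \<Longrightarrow> Re (P z) > 0"
    and z: "z \<in> ball 0 1"
  shows "(1 - (cmod z)\<^sup>2) * Re (P 0) * cmod (P z)
    \<le> Re (P z) * ((1 + (cmod z)\<^sup>2) * cmod (P 0) + 2 * cmod z * \<bar>Im (P 0)\<bar>)"
proof -
  define A where "A = P 0"
  define \<phi> where "\<phi> x = (P x - A) / (P x + cnj A)" for x
  have "Re A > 0" using pos[of 0] by (simp add: A_def)
  have nz: "P x + cnj A \<noteq> 0" if "x \<in> ball 0 1" for x
    using pos[OF that] \<open>Re A > 0\<close> by (auto simp: complex_eq_iff)
  have lt1: "cmod (\<phi> x) < 1" if "x \<in> ball 0 1" for x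
  proof -
    have "(cmod (P x + cnj A))\<^sup>2 - (cmod (P x - A))\<^sup>2 = 4 * (Re (P x) * Re A)"
      by (simp add: cmod_power2) algebra
    then have "(cmod (P x - A))\<^sup>2 < (cmod (P x + cnj A))\<^sup>2"
      using mult_pos_pos[OF pos[OF that] \<open>Re A > 0\<close>] by linarith
    then have "cmod (P x - A) < cmod (P x + cnj A)"
      by (rule power2_less_imp_less) simp
    then show ?thesis using nz[OF that] by (simp add: \<phi>_def norm_divide)
  qed
  define v where "v = \<phi> z"
  define \<rho> where "\<rho> = cmod v"
  define r where "r = cmod z"
  have "\<rho> \<le> r" unfolding \<rho>_def v_def r_def
  proof (rule Schwarz_Lemma(1))
    show "\<phi> holomorphic_on ball 0 1"
      unfolding \<phi>_def using nz by (auto intro!: holomorphic_intros hol)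
    show "\<phi> 0 = 0" by (simp add: \<phi>_def A_def)
  qed (use lt1 z in auto)
  have "0 \<le> \<rho>" "0 \<le> r" "r < 1" using z by (auto simp: \<rho>_def r_def)
  have w: "(1 - v) * (P z + cnj A) = A + cnj A" and Pw: "P z * (1 - v) = A + cnj A * v"
    using nz[OF z] by (simp_all add: v_def \<phi>_def field_simps)
  have "1 - v \<noteq> 0"
    using w \<open>Re A > 0\<close> by (auto simp: complex_eq_iff)
  then have wpos: "(cmod (1 - v))\<^sup>2 > 0" by simp
  have "Re (P z) * (cmod (1 - v))\<^sup>2 = Re (P z * (1 - v) * cnj (1 - v))"
    by (simp only: mult.assoc complex_norm_square[symmetric]) simp
  also have "\<dots> = Re ((A + cnj A * v) * cnj (1 - v))" by (simp only: Pw)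
  also have "\<dots> = (1 - \<rho>\<^sup>2) * Re A"
    by (simp add: \<rho>_def cmod_power2) algebra
  finally have ReP: "Re (P z) * (cmod (1 - v))\<^sup>2 = (1 - \<rho>\<^sup>2) * Re A" .
  have "cmod (P z) * (cmod (1 - v))\<^sup>2 = cmod ((A + cnj A * v) * (1 - v))"
    by (simp only: Pw[symmetric]) (simp add: norm_mult power2_eq_square)
  also have "(A + cnj A * v) * (1 - v) = A - (A - cnj A) * v - cnj A * v\<^sup>2"
    by algebra
  also have "cmod \<dots> \<le> cmod A + cmod ((A - cnj A) * v) + cmod (cnj A * v\<^sup>2)"
    by (meson norm_triangle_ineq4 order_trans add_mono order_refl)
  also have "\<dots> = (1 + \<rho>\<^sup>2) * cmod A + 2 * \<rho> * \<bar>Im A\<bar>"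
    by (simp add: \<rho>_def complex_diff_cnj norm_mult norm_power algebra_simps)
  also have "\<dots> \<le> (1 + r\<^sup>2) * cmod A + 2 * r * \<bar>Im A\<bar>"
    using \<open>\<rho> \<le> r\<close> \<open>0 \<le> \<rho>\<close> by (intro add_mono mult_right_mono) (auto intro: power_mono)
  finally have normP: "cmod (P z) * (cmod (1 - v))\<^sup>2 \<le> (1 + r\<^sup>2) * cmod A + 2 * r * \<bar>Im A\<bar>"
    (is "_ \<le> ?K") .
  have "?K \<ge> 0" using \<open>0 \<le> r\<close> by simp
  have "r\<^sup>2 \<le> 1" using \<open>0 \<le> r\<close> \<open>r < 1\<close> by (simp add: power_le_one)
  have "((1 - r\<^sup>2) * Re A * cmod (P z)) * (cmod (1 - v))\<^sup>2
      = (1 - r\<^sup>2) * Re A * (cmod (P z) * (cmod (1 - v))\<^sup>2)" by simp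
  also have "\<dots> \<le> (1 - r\<^sup>2) * Re A * ?K"
    using normP \<open>r\<^sup>2 \<le> 1\<close> \<open>Re A > 0\<close> by (intro mult_left_mono) auto
  also have "\<dots> \<le> (1 - \<rho>\<^sup>2) * Re A * ?K"
    using \<open>\<rho> \<le> r\<close> \<open>0 \<le> \<rho>\<close> \<open>Re A > 0\<close> \<open>?K \<ge> 0\<close>
    by (intro mult_right_mono) (auto intro: power_mono)
  also have "\<dots> = (Re (P z) * ?K) * (cmod (1 - v))\<^sup>2"
    by (simp only: ReP[symmetric]) (simp only: ac_simps)
  finally show ?thesis
    using wpos by (simp add: A_def r_def)
qed

text \<open>
  The map \<open>w \<mapsto> exp (\<i> \<pi> w / 2)\<close> carries the strip to the right half-plane, and the argument of the
  image is \<open>\<pi>/2\<close> times the real part of \<open>w\<close>.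
\<close>
lemma strip_holomorphic_cos_bound:
  assumes hol: "g holomorphic_on ball 0 1"
    and strip: "\<And>z. z \<in> ball 0 1 \<Longrightarrow> \<bar>Re (g z)\<bar> < 1"
    and z: "z \<in> ball 0 1"
  shows "(1 - (cmod z)\<^sup>2) * cos (pi/2 * Re (g 0))
    \<le> cos (pi/2 * Re (g z)) * (1 + (cmod z)\<^sup>2 + 2 * cmod z * \<bar>sin (pi/2 * Re (g 0))\<bar>)"
proof -
  define P where "P x = exp (\<i> * complex_of_real (pi/2) * g x)" for x
  have norm: "cmod (P x) = exp (- (pi/2 * Im (g x)))"
    and Re: "Re (P x) = cmod (P x) * cos (pi/2 * Re (g x))"
    and Im: "Im (P x) = cmod (P x) * sin (pi/2 * Re (g x))" for x
    by (simp_all add: P_def Re_exp Im_exp)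
  have npos: "cmod (P x) > 0" for x by (simp add: norm)
  have "Re (P x) > 0" if "x \<in> ball 0 1" for x
  proof -
    have "cos (pi/2 * Re (g x)) > 0"
      using mult_strict_left_mono[of "Re (g x)" 1 "pi/2"]
        mult_strict_left_mono[of "-1" "Re (g x)" "pi/2"] strip[OF that]
      by (intro cos_gt_zero_pi) (auto simp: abs_less_iff)
    then show ?thesis using npos[of x] by (simp add: Re)
  qed
  moreover have "P holomorphic_on ball 0 1"
    unfolding P_def by (intro holomorphic_intros hol)
  ultimately have *: "(1 - (cmod z)\<^sup>2) * Re (P 0) * cmod (P z)
    \<le> Re (P z) * ((1 + (cmod z)\<^sup>2) * cmod (P 0) + 2 * cmod z * \<bar>Im (P 0)\<bar>)"
    by (intro Re_pos_holomorphic_argument_bound z)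
  have "(cmod (P 0) * cmod (P z)) * ((1 - (cmod z)\<^sup>2) * cos (pi/2 * Re (g 0)))
    \<le> (cmod (P 0) * cmod (P z)) * (cos (pi/2 * Re (g z)) *
        (1 + (cmod z)\<^sup>2 + 2 * cmod z * \<bar>sin (pi/2 * Re (g 0))\<bar>))"
    using * unfolding Re Im by (simp add: abs_mult algebra_simps)
  then show ?thesis using npos[of 0] npos[of z] by (simp add: mult_le_cancel_left_pos)
qed

text \<open>
  Since \<open>cos (\<pi>/2 x) = sin (\<pi>/2 (1 - x)) \<le> \<pi>/2 (1 - x)\<close>, the cosine can be replaced by the distance
  of the real part from the edge of the strip. The estimate is asymptotically sharp at that edge, so
  the constant in the limit does not suffer.
\<close>
lemma strip_holomorphic_boundary_gap:
  assumes hol: "g holomorphic_on ball 0 1"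
    and strip: "\<And>z. z \<in> ball 0 1 \<Longrightarrow> \<bar>Re (g z)\<bar> < 1"
    and z: "z \<in> ball 0 1"
  shows "(1 - (cmod z)\<^sup>2) * cos (pi/2 * Re (g 0))
    \<le> pi/2 * (1 - Re (g z)) * (1 + (cmod z)\<^sup>2 + 2 * cmod z * \<bar>sin (pi/2 * Re (g 0))\<bar>)"
proof -
  have "cos (pi/2 * Re (g z)) = sin (pi/2 * (1 - Re (g z)))"
    by (simp add: right_diff_distrib sin_diff)
  also have "\<dots> \<le> pi/2 * (1 - Re (g z))"
    using strip[OF z] by (intro sin_x_le_x) (auto simp: abs_less_iff)
  finally have "cos (pi/2 * Re (g z)) \<le> pi/2 * (1 - Re (g z))" .
  then show ?thesis
    by (intro order_trans[OF strip_holomorphic_cos_bound[OF hol strip z]] mult_right_mono) auto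
qed

section \<open>The boundary derivative\<close>

lemma derivative_along_radius:
  fixes f :: "complex \<Rightarrow> complex"
  assumes diff: "(f has_derivative D) (at b within insert b (ball 0 1))"
    and b: "cmod b = 1" and fb: "cmod (f b) = 1"
  shows "((\<lambda>r. (1 - Re (cnj (f b) * f (r *\<^sub>R b))) / (1 - r)) \<longlongrightarrow> Re (cnj (f b) * D b)) (at_left 1)"
proof -
  have "((\<lambda>r. r *\<^sub>R b) has_derivative (\<lambda>h. h *\<^sub>R b)) (at 1 within {0..1})"
    by (auto intro!: derivative_eq_intros)
  moreover have "(f has_derivative D) (at (1 *\<^sub>R b) within (\<lambda>r. r *\<^sub>R b) ` {0..1})"
    using diff b by (auto intro!: has_derivative_subset[OF diff])
  ultimately have "((\<lambda>r. f (r *\<^sub>R b)) has_derivative (\<lambda>h. D (h *\<^sub>R b))) (at 1 within {0..1})"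
    by (rule has_derivative_in_compose)
  then have "((\<lambda>r. Re (cnj (f b) * f (r *\<^sub>R b))) has_derivative (\<lambda>h. Re (cnj (f b) * D (h *\<^sub>R b))))
      (at 1 within {0..1})"
    by (intro has_derivative_Re has_derivative_mult_right)
  then have "((\<lambda>r. Re (cnj (f b) * f (r *\<^sub>R b))) has_field_derivative Re (cnj (f b) * D b))
      (at 1 within {0..1})"
    by (rule has_derivative_imp_has_field_derivative)
       (simp add: linear_cmul[OF has_derivative_linear[OF diff]] algebra_simps)
  moreover have "Re (cnj (f b) * f (1 *\<^sub>R b)) = 1"
    using fb complex_norm_square[of "f b"]
    by (metis mult.commute of_real_1 one_complex.sel(1) power_one scaleR_one)
  ultimately have "((\<lambda>r. (Re (cnj (f b) * f (r *\<^sub>R b)) - 1) / (r - 1)) \<longlongrightarrow> Re (cnj (f b) * D b))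
      (at 1 within {0..1})"
    unfolding has_field_derivative_iff by metis
  then have "((\<lambda>r. (Re (cnj (f b) * f (r *\<^sub>R b)) - 1) / (r - 1)) \<longlongrightarrow> Re (cnj (f b) * D b))
      (at_left 1)"
    by (simp add: at_within_Icc_at_left)
  moreover have "(x - 1) / (r - 1) = (1 - x) / (1 - r)" for x r :: real
    by (metis minus_diff_eq minus_divide_divide)
  ultimately show ?thesis by (simp only:)
qed

lemma tan_quarter_pi_shift:
  fixes \<beta> :: real
  assumes "0 \<le> \<beta>" "\<beta> < pi/2"
  shows "1 / tan (pi/4 + \<beta>/2) = cos \<beta> / (1 + sin \<beta>)"
proof -
  have "cos \<beta> > 0" using assms by (intro cos_gt_zero_pi) auto
  have "sin \<beta> \<ge> 0" using assms by (intro sin_ge_zero) auto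
  have "tan (pi/4 + \<beta>/2) = cos \<beta> / (1 - sin \<beta>)"
    unfolding tan_half by (simp add: distrib_left sin_add cos_add)
  moreover have "cos \<beta> * cos \<beta> = (1 - sin \<beta>) * (1 + sin \<beta>)"
    using sin_cos_squared_add[of \<beta>] by (simp add: power2_eq_square algebra_simps)
  ultimately show ?thesis
    using \<open>cos \<beta> > 0\<close> \<open>sin \<beta> \<ge> 0\<close> by (simp add: frac_eq_eq)
qed

theorem theorem5:
  fixes f :: "complex \<Rightarrow> complex" and b :: complex and s :: real
    and D :: "complex \<Rightarrow> complex"
  assumes harm: "harmonic_on (ball 0 1) f"
    and maps: "f ` ball 0 1 \<subseteq> ball 0 1"
    and s: "s = tan (pi / 4 * (cmod (f 0) + 1))"
    and b: "b \<in> sphere 0 1"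
    and cont: "(f \<longlongrightarrow> f b) (at b within ball 0 1)"
    and fb: "cmod (f b) = 1"
    and diff: "(f has_derivative D) (at b within insert b (ball 0 1))"
  shows "onorm D \<ge> 2 / (s * pi)"
proof -
  have "cmod b = 1" using b by simp
  obtain g where hol: "g holomorphic_on ball 0 1"
    and g: "\<And>z. z \<in> ball 0 1 \<Longrightarrow> Re (g z) = Re (cnj (f b) * f z)"
    using harmonic_on_Re_holomorphic[OF harm convex_ball] by blast
  have Re_le: "\<bar>Re (cnj (f b) * w)\<bar> \<le> cmod w" for w
    using abs_Re_le_cmod[of "cnj (f b) * w"] fb by (simp add: norm_mult)
  have f_lt: "cmod (f z) < 1" if "z \<in> ball 0 1" for z
    using maps that by (auto simp: image_subset_iff)
  have strip: "\<bar>Re (g z)\<bar> < 1" if "z \<in> ball 0 1" for z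
    using Re_le[of "f z"] f_lt[OF that] g[OF that] by simp
  define \<alpha> where "\<alpha> = pi/2 * Re (g 0)"
  define \<beta> where "\<beta> = pi/2 * cmod (f 0)"
  define L where "L = Re (cnj (f b) * D b)"
  have "\<bar>\<alpha>\<bar> \<le> \<beta>"
    using Re_le[of "f 0"] g[of 0] by (simp add: \<alpha>_def \<beta>_def abs_mult)
  have "0 \<le> \<beta>" "\<beta> < pi/2" using f_lt[of 0] by (simp_all add: \<beta>_def)

  have lim: "((\<lambda>r. pi/2 * ((1 - Re (cnj (f b) * f (r *\<^sub>R b))) / (1 - r)) * (1 + r\<^sup>2 + 2 * r * \<bar>sin \<alpha>\<bar>))
      \<longlongrightarrow> pi/2 * L * (1 + 1\<^sup>2 + 2 * 1 * \<bar>sin \<alpha>\<bar>)) (at_left 1)"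
    unfolding L_def
    by (intro tendsto_intros derivative_along_radius[OF diff \<open>cmod b = 1\<close> fb])
  have lim': "((\<lambda>r. (1 + r) * cos \<alpha>) \<longlongrightarrow> (1 + 1) * cos \<alpha>) (at_left (1::real))"
    by (intro tendsto_intros)
  have "\<forall>\<^sub>F r in at_left 1. (1 + r) * cos \<alpha>
    \<le> pi/2 * ((1 - Re (cnj (f b) * f (r *\<^sub>R b))) / (1 - r)) * (1 + r\<^sup>2 + 2 * r * \<bar>sin \<alpha>\<bar>)"
    using eventually_at_left_real[of 0 1]
  proof (rule eventually_mono)
    fix r :: real assume r: "r \<in> {0<..<1}"
    have ball: "r *\<^sub>R b \<in> ball 0 1" and norm: "cmod (r *\<^sub>R b) = r"
      using r \<open>cmod b = 1\<close> by auto
    have cancel: "(1 - r) * (a * (x / (1 - r)) * k) = a * x * k" for a x k :: real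
      using r by simp
    have "(1 - r) * ((1 + r) * cos \<alpha>) = (1 - r\<^sup>2) * cos \<alpha>" by algebra
    also have "\<dots> \<le> pi/2 * (1 - Re (cnj (f b) * f (r *\<^sub>R b))) * (1 + r\<^sup>2 + 2 * r * \<bar>sin \<alpha>\<bar>)"
      using strip_holomorphic_boundary_gap[OF hol strip ball] unfolding norm g[OF ball] \<alpha>_def .
    also have "\<dots> = (1 - r) *
        (pi/2 * ((1 - Re (cnj (f b) * f (r *\<^sub>R b))) / (1 - r)) * (1 + r\<^sup>2 + 2 * r * \<bar>sin \<alpha>\<bar>))"
      using cancel by (simp only:)
    finally show "(1 + r) * cos \<alpha>
      \<le> pi/2 * ((1 - Re (cnj (f b) * f (r *\<^sub>R b))) / (1 - r)) * (1 + r\<^sup>2 + 2 * r * \<bar>sin \<alpha>\<bar>)"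
      using r by (simp only: mult_le_cancel_left_pos greaterThanLessThan_iff diff_gt_0_iff_gt)
  qed simp
  from tendsto_le[OF _ lim lim' this]
  have "cos \<alpha> \<le> pi/2 * L * (1 + \<bar>sin \<alpha>\<bar>)" by (simp add: algebra_simps)
  then have "cos \<alpha> / (1 + \<bar>sin \<alpha>\<bar>) \<le> pi/2 * L"
    by (simp add: pos_divide_le_eq add_pos_nonneg)
  then have L: "2/pi * (cos \<alpha> / (1 + \<bar>sin \<alpha>\<bar>)) \<le> L"
    by (simp add: pos_divide_le_eq mult.commute)

  have "cos \<beta> \<le> cos \<alpha>"
    using cos_monotone_0_pi_le[of "\<bar>\<alpha>\<bar>" \<beta>] \<open>\<bar>\<alpha>\<bar> \<le> \<beta>\<close> \<open>\<beta> < pi/2\<close> by simp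
  have "\<bar>sin \<alpha>\<bar> = sin \<bar>\<alpha>\<bar>"
    using \<open>\<bar>\<alpha>\<bar> \<le> \<beta>\<close> \<open>\<beta> < pi/2\<close> sin_ge_zero[of "\<bar>\<alpha>\<bar>"] by (cases "\<alpha> \<ge> 0") auto
  also have "\<dots> \<le> sin \<beta>"
    using \<open>\<bar>\<alpha>\<bar> \<le> \<beta>\<close> \<open>\<beta> < pi/2\<close> by (intro sin_monotone_2pi_le) auto
  finally have "\<bar>sin \<alpha>\<bar> \<le> sin \<beta>" .
  have "cos \<beta> \<ge> 0" using \<open>0 \<le> \<beta>\<close> \<open>\<beta> < pi/2\<close> by (intro cos_ge_zero) auto
  have "2 / (s * pi) = 2/pi * (1 / tan (pi/4 + \<beta>/2))"
    by (simp add: s \<beta>_def field_simps)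
  also have "\<dots> = 2/pi * (cos \<beta> / (1 + sin \<beta>))"
    by (simp only: tan_quarter_pi_shift[OF \<open>0 \<le> \<beta>\<close> \<open>\<beta> < pi/2\<close>])
  also have "\<dots> \<le> 2/pi * (cos \<alpha> / (1 + \<bar>sin \<alpha>\<bar>))"
    using \<open>cos \<beta> \<le> cos \<alpha>\<close> \<open>\<bar>sin \<alpha>\<bar> \<le> sin \<beta>\<close> \<open>cos \<beta> \<ge> 0\<close>
    by (intro mult_left_mono frac_le) auto
  also have "\<dots> \<le> L" by (rule L)
  also have "\<dots> \<le> cmod (D b)" using Re_le[of "D b"] by (simp add: L_def)
  also have "\<dots> \<le> onorm D"
    using onorm[OF has_derivative_bounded_linear[OF diff], of b] \<open>cmod b = 1\<close> by simp
  finally show ?thesis .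
qed

end
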